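(* Let $(\mathcal{A},\equiv)$ be an equivalence family with underlying set $A=\bigcup\mathcal{A}$, let $B=(B,\textrm{Con}_B,\vdash_B)$ be a general event structure, and let $g:(\mathcal{A},\equiv)\to(\mathcal{C}^\infty(B),=)$ be a map of equivalence families. Then there is a unique map $k:\mathit{col}(\mathcal{A},\equiv)\to B$ of general event structures such that $\mathit{fam}(k)\circ\eta_A=g$, i.e. $k(\{a\}_\equiv)$ is defined iff $g(a)$ is defined, and then $k(\{a\}_\equiv)=g(a)$, for all $a\in A$.
   Context: A general event structure $(E,\textrm{Con},\vdash)$: a set $E$, a non-empty set $\textrm{Con}$ of finite subsets of $E$ closed under subsets, and a relation $\vdash\subseteq\textrm{Con}\times E$ such that $Y\in\textrm{Con}$, $Y\supseteq X$, $X\vdash e$ imply $Y\vdash e$. A configuration is $x\subseteq E$ with every finite subset in $\textrm{Con}$ and such that for every $e\in x$ there are $e_1,\dots,e_n\in x$ with $e_n=e$ and $\{e_1,\dots,e_{i-1}\}\vdash e_i$ for all $i\leq n$; $\mathcal{C}^\infty(E)$ denotes the configurations. A map of general event structures $f:(E,\textrm{Con},\vdash)\to(E',\textrm{Con}',\vdash')$ is a partial function $f:E\rightharpoonup E'$ such that for all $X\in\textrm{Con}$: $fX\in\textrm{Con}'$; $f$ is injective on the elements of $X$ where it is defined; and $X\vdash e$ with $f(e)$ defined implies $fX\vdash'f(e)$. A family of configurations is a non-empty family $\mathcal{A}$ of sets such that finitely compatible subfamilies (every finite subset contained in some member) have union in $\mathcal{A}$, and for $e\in x\in\mathcal{A}$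 there are $e_1,\dots,e_n=e$ in $x$ with $\{e_1,\dots,e_i\}\in\mathcal{A}$ for all $i$. An equivalence family $(\mathcal{A},\equiv_A)$ is such a family with an equivalence relation on $\bigcup\mathcal{A}$. A map of equivalence families $f:(\mathcal{A},\equiv_A)\to(\mathcal{B},\equiv_B)$ is a partial function $\bigcup\mathcal{A}\rightharpoonup\bigcup\mathcal{B}$ preserving $\equiv$ (if $a_1\equiv_A a_2$ then $f(a_1),f(a_2)$ both undefined or both defined and $\equiv_B$-equivalent) such that for $x\in\mathcal{A}$, $fx\in\mathcal{B}$ and for $a_1,a_2\in x$, $f(a_1)\equiv_B f(a_2)$ implies $a_1\equiv_A a_2$. $\mathit{fam}(B)=(\mathcal{C}^\infty(B),=)$ with $=$ the identity on $\bigcup\mathcal{C}^\infty(B)$, and $\mathit{fam}(k)=k$ on maps. $\mathit{col}(\mathcal{A},\equiv)=(E,\textrm{Con},\vdash)$ where $E=A_\equiv$ is the set of $\equiv$-classes of $A$; $X\in\textrm{Con}$ iff $X$ is a finite subset of $y_\equiv=\{\{a\}_\equiv\mid a\in y\}$ for some $y\in\mathcal{A}$; $X\vdash e$ iff $e\in E$, $X\in\textrm{Con}$ and $e\in y_\equiv\subseteq X\cup\{e\}$ for some $y\in\mathcal{A}$. The unit $\eta_A:(\mathcal{A},\equiv)\to\mathit{fam}(\mathit{col}(\mathcal{A},\equiv))$ is $\eta_A(a)=\{a\}_\equiv$. *)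

theory Defs
  imports Main
begin

text \<open>Partial functions are encoded as maps \<open>'a \<Rightarrow> 'b option\<close>; being a partial
  function from \<open>S\<close> to \<open>T\<close> means having \<open>dom\<close> within \<open>S\<close> and \<open>ran\<close> within \<open>T\<close>. In
  particular a map is \<open>None\<close> off \<open>S\<close>, so equality of HOL functions is equality of partial
  functions on \<open>S\<close>.\<close>

definition pfun :: "'a set \<Rightarrow> 'b set \<Rightarrow> ('a \<Rightarrow> 'b option) \<Rightarrow> bool" where
  "pfun S T f \<longleftrightarrow> dom f \<subseteq> S \<and> ran f \<subseteq> T"

definition pimage :: "('a \<Rightarrow> 'b option) \<Rightarrow> 'a set \<Rightarrow> 'b set" where
  "pimage f X = {b. \<exists>a\<in>X. f a = Some b}"

record 'e event_structure =
  events :: "'e set"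
  Con :: "'e set set"
  enabling :: "('e set \<times> 'e) set"

definition general_event_structure :: "'e event_structure \<Rightarrow> bool" where
  "general_event_structure E \<longleftrightarrow>
     Con E \<noteq> {} \<and>
     (\<forall>X\<in>Con E. finite X \<and> X \<subseteq> events E) \<and>
     (\<forall>X\<in>Con E. \<forall>Y\<subseteq>X. Y \<in> Con E) \<and>
     enabling E \<subseteq> Con E \<times> events E \<and>
     (\<forall>X Y e. Y \<in> Con E \<and> X \<subseteq> Y \<and> (X, e) \<in> enabling E \<longrightarrow> (Y, e) \<in> enabling E)"

definition configurations :: "'e event_structure \<Rightarrow> 'e set set" where
  "configurations E =
     {x. x \<subseteq> events E \<and>
         (\<forall>X. finite X \<and> X \<subseteq> x \<longrightarrow> X \<in> Con E) \<and>
         (\<forall>e\<in>x. \<exists>es. es \<noteq> [] \<and> set es \<subseteq> x \<and> last es = e \<and>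
            (\<forall>i<length es. (set (take i es), es ! i) \<in> enabling E))}"

definition es_map ::
    "'e event_structure \<Rightarrow> 'f event_structure \<Rightarrow> ('e \<Rightarrow> 'f option) \<Rightarrow> bool" where
  "es_map E E' f \<longleftrightarrow>
     pfun (events E) (events E') f \<and>
     (\<forall>X\<in>Con E.
        pimage f X \<in> Con E' \<and>
        inj_on f (X \<inter> dom f) \<and>
        (\<forall>e e'. (X, e) \<in> enabling E \<and> f e = Some e' \<longrightarrow> (pimage f X, e') \<in> enabling E'))"

definition finitely_compatible :: "'a set set \<Rightarrow> 'a set set \<Rightarrow> bool" where
  "finitely_compatible \<A> Z \<longleftrightarrow>
     (\<forall>Z'. finite Z' \<and> Z' \<subseteq> Z \<longrightarrow> (\<exists>x\<in>\<A>. \<forall>z\<in>Z'. z \<subseteq> x))"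

definition configuration_family :: "'a set set \<Rightarrow> bool" where
  "configuration_family \<A> \<longleftrightarrow>
     \<A> \<noteq> {} \<and>
     (\<forall>Z\<subseteq>\<A>. finitely_compatible \<A> Z \<longrightarrow> \<Union>Z \<in> \<A>) \<and>
     (\<forall>x\<in>\<A>. \<forall>e\<in>x. \<exists>es. es \<noteq> [] \<and> set es \<subseteq> x \<and> last es = e \<and>
        (\<forall>i\<le>length es. set (take i es) \<in> \<A>))"

record 'a equiv_family =
  family :: "'a set set"
  equivalence :: "('a \<times> 'a) set"

definition equivalence_family :: "'a equiv_family \<Rightarrow> bool" where
  "equivalence_family \<A> \<longleftrightarrow>
     configuration_family (family \<A>) \<and> equiv (\<Union>(family \<A>)) (equivalence \<A>)"

text \<open>In the last clause, a related pair of images presupposes that both are defined.\<close>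

definition ef_map :: "'a equiv_family \<Rightarrow> 'b equiv_family \<Rightarrow> ('a \<Rightarrow> 'b option) \<Rightarrow> bool" where
  "ef_map \<A> \<B> f \<longleftrightarrow>
     pfun (\<Union>(family \<A>)) (\<Union>(family \<B>)) f \<and>
     (\<forall>(a1, a2)\<in>equivalence \<A>.
        f a1 = None \<and> f a2 = None \<or>
        (\<exists>b1 b2. f a1 = Some b1 \<and> f a2 = Some b2 \<and> (b1, b2) \<in> equivalence \<B>)) \<and>
     (\<forall>x\<in>family \<A>.
        pimage f x \<in> family \<B> \<and>
        (\<forall>a1\<in>x. \<forall>a2\<in>x. \<forall>b1 b2.
           f a1 = Some b1 \<and> f a2 = Some b2 \<and> (b1, b2) \<in> equivalence \<B> \<longrightarrow>
           (a1, a2) \<in> equivalence \<A>))"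

definition fam :: "'e event_structure \<Rightarrow> 'e equiv_family" where
  "fam E = \<lparr>family = configurations E, equivalence = Id_on (\<Union>(configurations E))\<rparr>"

definition fam_map :: "('e \<Rightarrow> 'f option) \<Rightarrow> ('e \<Rightarrow> 'f option)" where
  "fam_map k = k"

definition eclass :: "'a equiv_family \<Rightarrow> 'a \<Rightarrow> 'a set" where
  "eclass \<A> a = equivalence \<A> `` {a}"

definition col :: "'a equiv_family \<Rightarrow> 'a set event_structure" where
  "col \<A> =
     (let E = \<Union>(family \<A>) // equivalence \<A>;
          C = {X. finite X \<and> (\<exists>y\<in>family \<A>. X \<subseteq> eclass \<A> ` y)}
      in \<lparr>events = E,
          Con = C,
          enabling = {(X, e). e \<in> E \<and> X \<in> C \<and>
            (\<exists>y\<in>family \<A>. e \<in> eclass \<A> ` y \<and> eclass \<A> ` y \<subseteq> X \<union> {e})}\<rparr>)"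

definition eta :: "'a equiv_family \<Rightarrow> 'a \<Rightarrow> 'a set option" where
  "eta \<A> a = (if a \<in> \<Union>(family \<A>) then Some (eclass \<A> a) else None)"

lemma empty_in_family:
  assumes "configuration_family \<A>"
  shows "{} \<in> \<A>"
proof -
  have "finitely_compatible \<A> {}"
    using assms by (auto simp: configuration_family_def finitely_compatible_def)
  then have "\<Union>{} \<in> \<A>"
    using assms unfolding configuration_family_def by blast
  then show ?thesis by simp
qed

lemma enabling_col_iff:
  "(X, e) \<in> enabling (col \<A>) \<longleftrightarrow> e \<in> events (col \<A>) \<and> X \<in> Con (col \<A>) \<and>
     (\<exists>y\<in>family \<A>. e \<in> eclass \<A> ` y \<and> eclass \<A> ` y \<subseteq> X \<union> {e})"
  by (simp add: col_def Let_def)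

lemma general_event_structure_col:
  assumes "equivalence_family \<A>"
  shows "general_event_structure (col \<A>)"
proof -
  have "{} \<in> family \<A>"
    using assms empty_in_family by (auto simp: equivalence_family_def)
  then have "{} \<in> Con (col \<A>)"
    by (auto simp: col_def Let_def)
  moreover have "X \<subseteq> events (col \<A>)" if "X \<in> Con (col \<A>)" for X
    using that by (fastforce simp: col_def Let_def eclass_def quotient_def)
  moreover have "(Y, e) \<in> enabling (col \<A>)"
    if h: "Y \<in> Con (col \<A>)" "X \<subseteq> Y" "(X, e) \<in> enabling (col \<A>)" for X Y e
  proof -
    obtain y where "y \<in> family \<A>" "e \<in> eclass \<A> ` y" "eclass \<A> ` y \<subseteq> X \<union> {e}"
      and "e \<in> events (col \<A>)"
      using h(3) unfolding enabling_col_iff by blast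
    moreover from this h(2) have "eclass \<A> ` y \<subseteq> Y \<union> {e}" by blast
    ultimately show ?thesis
      using h(1) unfolding enabling_col_iff by blast
  qed
  moreover have "finite X" if "X \<in> Con (col \<A>)" for X
    using that by (auto simp: col_def Let_def)
  moreover have "Y \<in> Con (col \<A>)" if "X \<in> Con (col \<A>)" "Y \<subseteq> X" for X Y
    using that by (auto simp: col_def Let_def intro: finite_subset)
  moreover have "enabling (col \<A>) \<subseteq> Con (col \<A>) \<times> events (col \<A>)"
    by (auto simp: col_def Let_def)
  ultimately show ?thesis
    unfolding general_event_structure_def by (intro conjI allI impI ballI) auto
qed

lemma configurations_subset_events: "x \<in> configurations E \<Longrightarrow> x \<subseteq> events E"
  by (simp add: configurations_def)

lemma configurationsI:
  assumes "x \<subseteq> events E"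
    and "\<And>X. finite X \<Longrightarrow> X \<subseteq> x \<Longrightarrow> X \<in> Con E"
    and "\<And>e. e \<in> x \<Longrightarrow> \<exists>es. es \<noteq> [] \<and> set es \<subseteq> x \<and> last es = e \<and>
      (\<forall>i<length es. (set (take i es), es ! i) \<in> enabling E)"
  shows "x \<in> configurations E"
  using assms by (simp add: configurations_def)

lemma configurationsE:
  assumes "x \<in> configurations E" and "e \<in> x"
  obtains es where "es \<noteq> []" "set es \<subseteq> x" "last es = e"
    "\<forall>i<length es. (set (take i es), es ! i) \<in> enabling E"
  using assms by (auto simp: configurations_def)

lemma configuration_family_configurations:
  assumes "general_event_structure E"
  shows "configuration_family (configurations E)"
  unfolding configuration_family_def
proof (intro conjI allI impI ballI)
  have "{} \<in> Con E"
    using assms by (force simp: general_event_structure_def)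
  then have "{} \<in> configurations E"
    by (simp add: configurations_def)
  then show "configurations E \<noteq> {}" by blast
next
  fix Z assume Z: "Z \<subseteq> configurations E" "finitely_compatible (configurations E) Z"
  have "X \<in> Con E" if X: "finite X" "X \<subseteq> \<Union>Z" for X
  proof -
    obtain Z' where "finite Z'" "Z' \<subseteq> Z" "X \<subseteq> \<Union>Z'"
      by (rule finite_subset_Union[OF X])
    moreover from this obtain x where "x \<in> configurations E" "\<forall>z\<in>Z'. z \<subseteq> x"
      using Z(2) by (auto simp: finitely_compatible_def)
    ultimately have "X \<subseteq> x" by blast
    then show ?thesis
      using \<open>x \<in> configurations E\<close> \<open>finite X\<close> by (simp add: configurations_def)
  qed
  moreover have "\<Union>Z \<subseteq> events E"
    using Z(1) by (auto dest: configurations_subset_events)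
  moreover have "\<exists>es. es \<noteq> [] \<and> set es \<subseteq> \<Union>Z \<and> last es = e \<and>
      (\<forall>i<length es. (set (take i es), es ! i) \<in> enabling E)" if e: "e \<in> \<Union>Z" for e
  proof -
    obtain z where z: "z \<in> Z" "e \<in> z" using e by blast
    then have "z \<in> configurations E" using Z(1) by blast
    then obtain es where "es \<noteq> []" "set es \<subseteq> z" "last es = e"
      "\<forall>i<length es. (set (take i es), es ! i) \<in> enabling E"
      using z(2) by (rule configurationsE)
    with z(1) show ?thesis by (intro exI[of _ es]) auto
  qed
  ultimately show "\<Union>Z \<in> configurations E"
    by (intro configurationsI)
next
  fix x e assume x: "x \<in> configurations E" and e: "e \<in> x"
  then obtain es where es: "es \<noteq> []" "set es \<subseteq> x" "last es = e"
    and en: "\<forall>i<length es. (set (take i es), es ! i) \<in> enabling E"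
    by (rule configurationsE)
  have "set (take i es) \<in> configurations E" if "i \<le> length es" for i
  proof -
    have sub: "set (take i es) \<subseteq> x"
      using es(2) set_take_subset by fastforce
    have "\<exists>fs. fs \<noteq> [] \<and> set fs \<subseteq> set (take i es) \<and> last fs = d \<and>
        (\<forall>j<length fs. (set (take j fs), fs ! j) \<in> enabling E)"
      if d: "d \<in> set (take i es)" for d
    proof -
      obtain j where j: "j < i" "j < length es" "d = es ! j"
        using d by (auto simp: in_set_conv_nth)
      have "take (Suc j) es = take j es @ [d]"
        using j by (simp add: take_Suc_conv_app_nth)
      then have "last (take (Suc j) es) = d" "take (Suc j) es \<noteq> []"
        by simp_all
      moreover have "set (take (Suc j) es) \<subseteq> set (take i es)"
        using j(1) by (intro set_take_subset_set_take) simp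
      moreover have "\<forall>l<length (take (Suc j) es).
          (set (take l (take (Suc j) es)), take (Suc j) es ! l) \<in> enabling E"
        using en by (simp add: min_def)
      ultimately show ?thesis by blast
    qed
    moreover have "X \<in> Con E" if "finite X" "X \<subseteq> set (take i es)" for X
      using that sub x by (auto simp: configurations_def)
    moreover have "set (take i es) \<subseteq> events E"
      using sub configurations_subset_events[OF x] by blast
    ultimately show ?thesis
      by (intro configurationsI)
  qed
  with es show "\<exists>es. es \<noteq> [] \<and> set es \<subseteq> x \<and> last es = e \<and>
      (\<forall>i\<le>length es. set (take i es) \<in> configurations E)"
    by blast
qed

lemma equivalence_family_fam:
  assumes "general_event_structure E"
  shows "equivalence_family (fam E)"
  using configuration_family_configurations[OF assms]
  by (auto simp: equivalence_family_def fam_def equiv_def refl_on_def sym_def trans_def)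

lemma eclass_image_configuration:
  assumes "equivalence_family \<A>" and "x \<in> family \<A>"
  shows "eclass \<A> ` x \<in> configurations (col \<A>)"
proof -
  have "\<exists>es. es \<noteq> [] \<and> set es \<subseteq> eclass \<A> ` x \<and> last es = eclass \<A> a \<and>
      (\<forall>i<length es. (set (take i es), es ! i) \<in> enabling (col \<A>))" if a: "a \<in> x" for a
  proof -
    obtain es where es: "es \<noteq> []" "set es \<subseteq> x" "last es = a"
      and fm: "\<forall>i\<le>length es. set (take i es) \<in> family \<A>"
      using assms a unfolding equivalence_family_def configuration_family_def by meson
    have "(set (take i (map (eclass \<A>) es)), map (eclass \<A>) es ! i) \<in> enabling (col \<A>)"
      if i: "i < length es" for i
    proof -
      have "eclass \<A> (es ! i) \<in> \<Union>(family \<A>) // equivalence \<A>"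
        using i es(2) assms(2) nth_mem[OF i] unfolding eclass_def by (blast intro: quotientI)
      moreover have "set (take i es) \<in> family \<A>" "set (take (Suc i) es) \<in> family \<A>"
        using fm i by simp_all
      moreover have "set (take (Suc i) es) = insert (es ! i) (set (take i es))"
        using i by (simp add: take_Suc_conv_app_nth)
      moreover have "\<exists>y\<in>family \<A>. eclass \<A> (es ! i) \<in> eclass \<A> ` y \<and>
          eclass \<A> ` y \<subseteq> eclass \<A> ` set (take i es) \<union> {eclass \<A> (es ! i)}"
        using calculation by (intro bexI[of _ "set (take (Suc i) es)"]) auto
      moreover have "\<exists>y\<in>family \<A>. eclass \<A> ` set (take i es) \<subseteq> eclass \<A> ` y"
        using calculation(2) by blast
      ultimately show ?thesis
        using i by (simp add: col_def Let_def take_map)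
    qed
    with es show ?thesis
      by (intro exI[of _ "map (eclass \<A>) es"]) (auto simp: last_map)
  qed
  moreover have "eclass \<A> ` x \<subseteq> events (col \<A>)"
    using assms(2) by (auto simp: col_def Let_def eclass_def intro!: quotientI)
  moreover have "X \<in> Con (col \<A>)" if "finite X" "X \<subseteq> eclass \<A> ` x" for X
    using that assms(2) by (auto simp: col_def Let_def)
  ultimately show ?thesis
    by (intro configurationsI) (simp_all, metis imageE)
qed

text \<open>Every event of \<open>col\<close> lies in a configuration, so a map out of \<open>col\<close> needs no
  restriction to become a partial function on \<open>\<Union>(family (fam (col \<A>)))\<close>, as \<open>fam_map\<close>
  presupposes.\<close>

lemma Union_family_fam_col:
  assumes "equivalence_family \<A>"
  shows "\<Union>(family (fam (col \<A>))) = events (col \<A>)"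
proof
  show "\<Union>(family (fam (col \<A>))) \<subseteq> events (col \<A>)"
    by (auto simp: fam_def dest: configurations_subset_events)
  show "events (col \<A>) \<subseteq> \<Union>(family (fam (col \<A>)))"
  proof
    fix c assume "c \<in> events (col \<A>)"
    then obtain a x where "a \<in> x" "x \<in> family \<A>" "c = eclass \<A> a"
      by (auto simp: col_def Let_def eclass_def elim!: quotientE)
    then show "c \<in> \<Union>(family (fam (col \<A>)))"
      using eclass_image_configuration[OF assms] by (auto simp: fam_def)
  qed
qed

lemma ef_map_eta:
  assumes "equivalence_family \<A>"
  shows "ef_map \<A> (fam (col \<A>)) (eta \<A>)"
proof -
  let ?A = "\<Union>(family \<A>)" and ?R = "equivalence \<A>"
  have eq: "equiv ?A ?R"
    using assms by (simp add: equivalence_family_def)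
  have img: "pimage (eta \<A>) x = eclass \<A> ` x" if "x \<in> family \<A>" for x
    using that by (auto simp: pimage_def eta_def)
  have mem: "eclass \<A> a \<in> \<Union>(configurations (col \<A>))" if "a \<in> ?A" for a
    using that eclass_image_configuration[OF assms] by blast
  have "pfun ?A (\<Union>(family (fam (col \<A>)))) (eta \<A>)"
    using mem by (auto simp: pfun_def fam_def eta_def ran_def split: if_splits)
  moreover have "eta \<A> a1 = Some (eclass \<A> a1) \<and> eta \<A> a2 = Some (eclass \<A> a2) \<and>
      (eclass \<A> a1, eclass \<A> a2) \<in> equivalence (fam (col \<A>))" if r: "(a1, a2) \<in> ?R" for a1 a2
  proof -
    have "a1 \<in> ?A" "a2 \<in> ?A"
      using eq r unfolding equiv_def by blast+
    moreover have "eclass \<A> a1 = eclass \<A> a2"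
      using equiv_class_eq[OF eq r] by (simp add: eclass_def)
    ultimately show ?thesis
      using mem[of a2] by (simp add: eta_def fam_def Id_on_def)
  qed
  moreover have "pimage (eta \<A>) x \<in> family (fam (col \<A>))" if "x \<in> family \<A>" for x
    using eclass_image_configuration[OF assms that] by (simp add: img[OF that] fam_def)
  moreover have "(a1, a2) \<in> ?R" if "eta \<A> a1 = Some b1" "eta \<A> a2 = Some b2"
      "(b1, b2) \<in> equivalence (fam (col \<A>))" for a1 a2 b1 b2
  proof -
    have "?R `` {a1} = ?R `` {a2}" "a2 \<in> ?A"
      using that by (auto simp: eta_def fam_def eclass_def split: if_splits)
    then show ?thesis
      using eq_equiv_class[OF _ eq] by blast
  qed
  ultimately show ?thesis
    unfolding ef_map_def by blast
qed

end

theory Submission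
  imports Defs
begin

text \<open>Since \<open>g\<close> identifies equivalent elements, it factors through \<open>\<equiv>\<close>-classes by a unique
  partial function \<open>k\<close>. The consistency and injectivity conditions on \<open>k\<close> come directly from those
  on \<open>g\<close>. For enabling, suppose \<open>X \<turnstile> e\<close> is witnessed by \<open>y\<close>. The image \<open>g y\<close> is a configuration
  of \<open>B\<close> containing \<open>k e\<close>, so \<open>k e\<close> is enabled by a subset of \<open>g y\<close> that avoids \<open>k e\<close> itself, and
  such a subset lies in \<open>k X\<close>.\<close>

text \<open>Cut the securing sequence of \<open>e\<close> at the first occurrence of \<open>e\<close>.\<close>

lemma configuration_enabling_without:
  assumes "x \<in> configurations E" and "e \<in> x"
  obtains Y where "Y \<subseteq> x - {e}" "(Y, e) \<in> enabling E"
proof -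
  obtain es where es: "es \<noteq> []" "set es \<subseteq> x" "last es = e"
    and en: "\<forall>i<length es. (set (take i es), es ! i) \<in> enabling E"
    using assms by (rule configurationsE)
  then have "e \<in> set es" by auto
  then obtain ys zs where split: "es = ys @ e # zs" "e \<notin> set ys"
    by (auto dest: split_list_first)
  then have "(set ys, e) \<in> enabling E"
    using en[rule_format, of "length ys"] by simp
  moreover have "set ys \<subseteq> x - {e}"
    using es(2) split by auto
  ultimately show thesis by (rule that[rotated])
qed

lemma pimage_mono: "X \<subseteq> Y \<Longrightarrow> pimage f X \<subseteq> pimage f Y"
  by (auto simp: pimage_def)

lemma finite_pimage:
  assumes "finite X"
  shows "finite (pimage f X)"
proof -
  have "pimage f X \<subseteq> (\<lambda>a. the (f a)) ` X"
    by (force simp: pimage_def)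
  then show ?thesis
    using assms finite_surj by blast
qed

lemma events_col_eq: "events (col \<A>) = eclass \<A> ` \<Union>(family \<A>)"
  by (auto simp: col_def Let_def eclass_def quotient_def)

lemma Con_col_iff:
  "X \<in> Con (col \<A>) \<longleftrightarrow> finite X \<and> (\<exists>y\<in>family \<A>. X \<subseteq> eclass \<A> ` y)"
  by (simp add: col_def Let_def)

lemma eclass_eq_iff:
  assumes "equivalence_family \<A>" "a \<in> \<Union>(family \<A>)" "a' \<in> \<Union>(family \<A>)"
  shows "eclass \<A> a = eclass \<A> a' \<longleftrightarrow> (a, a') \<in> equivalence \<A>"
  using assms eq_equiv_class_iff unfolding eclass_def equivalence_family_def by fast

text \<open>The equivalence of \<open>fam B\<close> is a restriction of the identity, so preserving
  it means equality of values; the case of both undefined is absorbed by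
  \<open>None = None\<close>.\<close>

lemma ef_map_fam_equiv:
  assumes "ef_map \<A> (fam B) g" "(a, a') \<in> equivalence \<A>"
  shows "g a = g a'"
proof -
  have "g a = None \<and> g a' = None \<or>
      (\<exists>b b'. g a = Some b \<and> g a' = Some b' \<and> (b, b') \<in> equivalence (fam B))"
    using assms(1)[unfolded ef_map_def, THEN conjunct2, THEN conjunct1, THEN bspec, OF assms(2)]
    by simp
  then show ?thesis
    by (auto simp: fam_def)
qed

lemma ef_map_fam_configuration:
  assumes "ef_map \<A> (fam B) g" "y \<in> family \<A>"
  shows "pimage g y \<in> configurations B"
  using assms by (simp add: ef_map_def fam_def)

lemma ef_map_fam_reflects:
  assumes "ef_map \<A> (fam B) g" "y \<in> family \<A>" "a \<in> y" "a' \<in> y"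
    and "g a = Some b" "g a' = Some b"
  shows "(a, a') \<in> equivalence \<A>"
proof -
  \<comment> \<open>The identity of \<open>fam B\<close> relates only elements of configurations, so
    \<open>b\<close> must first be placed in one, namely the image of \<open>y\<close>.\<close>
  have "b \<in> pimage g y"
    using assms by (auto simp: pimage_def)
  then have "(b, b) \<in> equivalence (fam B)"
    using ef_map_fam_configuration[OF assms(1,2)] by (auto simp: fam_def)
  then show ?thesis
    using assms unfolding ef_map_def by blast
qed

lemma ef_map_dom:
  assumes "ef_map \<A> \<B> g"
  shows "dom g \<subseteq> \<Union>(family \<A>)"
  using assms by (simp add: ef_map_def pfun_def)

lemma ef_map_factors_eclass:
  assumes "equivalence_family \<A>" and "ef_map \<A> (fam B) g"
  obtains k where "dom k \<subseteq> events (col \<A>)"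
    "\<And>a. a \<in> \<Union>(family \<A>) \<Longrightarrow> k (eclass \<A> a) = g a"
proof
  \<comment> \<open>The choice of representative is harmless because \<open>g\<close> is constant on
    classes.\<close>
  let ?rep = "inv_into (\<Union>(family \<A>)) (eclass \<A>)"
  let ?k = "\<lambda>c. if c \<in> events (col \<A>) then g (?rep c) else None"
  show "dom ?k \<subseteq> events (col \<A>)"
    by (auto split: if_splits)
  fix a assume a: "a \<in> \<Union>(family \<A>)"
  then have c: "eclass \<A> a \<in> eclass \<A> ` \<Union>(family \<A>)" by (rule imageI)
  have "(?rep (eclass \<A> a), a) \<in> equivalence \<A>"
    using eclass_eq_iff[OF assms(1) inv_into_into[OF c] a] f_inv_into_f[OF c] by simp
  then have "g (?rep (eclass \<A> a)) = g a"
    using ef_map_fam_equiv[OF assms(2)] by blast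
  then show "?k (eclass \<A> a) = g a"
    using c by (simp add: events_col_eq)
qed

lemma es_map_col_factor:
  assumes A: "equivalence_family \<A>" and B: "general_event_structure B"
    and g: "ef_map \<A> (fam B) g"
    and dom: "dom k \<subseteq> events (col \<A>)"
    and k: "\<And>a. a \<in> \<Union>(family \<A>) \<Longrightarrow> k (eclass \<A> a) = g a"
  shows "es_map (col \<A>) B k"
proof -
  have img: "pimage k (eclass \<A> ` y) = pimage g y" if "y \<in> family \<A>" for y
  proof -
    have "k (eclass \<A> a) = g a" if "a \<in> y" for a
      using that \<open>y \<in> family \<A>\<close> by (intro k) blast
    then show ?thesis
      by (simp add: pimage_def)
  qed
  have Con: "pimage k X \<in> Con B" if X: "X \<in> Con (col \<A>)" for X
  proof -
    obtain y where y: "finite X" "y \<in> family \<A>" "X \<subseteq> eclass \<A> ` y"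
      using X unfolding Con_col_iff by blast
    then have "pimage k X \<subseteq> pimage g y"
      using pimage_mono img by metis
    then show ?thesis
      using ef_map_fam_configuration[OF g y(2)] finite_pimage[OF y(1), of k]
      unfolding configurations_def by blast
  qed
  have inj: "inj_on k (X \<inter> dom k)" if X: "X \<in> Con (col \<A>)" for X
  proof (rule inj_onI)
    fix c c' assume c: "c \<in> X \<inter> dom k" "c' \<in> X \<inter> dom k" "k c = k c'"
    obtain y where y: "y \<in> family \<A>" "X \<subseteq> eclass \<A> ` y"
      using X unfolding Con_col_iff by blast
    \<comment> \<open>Both representatives come from the same member \<open>y\<close>:
      \<open>g\<close> reflects equivalence only within a single member of the family.\<close>
    then obtain a a' where a: "a \<in> y" "a' \<in> y" "c = eclass \<A> a" "c' = eclass \<A> a'"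
      using c by blast
    have U: "a \<in> \<Union>(family \<A>)" "a' \<in> \<Union>(family \<A>)"
      using a y by blast+
    obtain b where "k c = Some b"
      using c(1) by auto
    then have "g a = Some b" "g a' = Some b"
      using a c(3) k U by simp_all
    then have "(a, a') \<in> equivalence \<A>"
      by (rule ef_map_fam_reflects[OF g y(1) a(1,2)])
    then show "c = c'"
      using a eclass_eq_iff[OF A U] by simp
  qed
  have enab: "(pimage k X, b) \<in> enabling B" if X: "(X, e) \<in> enabling (col \<A>)" "k e = Some b" for X e b
  proof -
    obtain y where y: "X \<in> Con (col \<A>)" "y \<in> family \<A>" "e \<in> eclass \<A> ` y"
      "eclass \<A> ` y \<subseteq> X \<union> {e}"
      using X(1) unfolding enabling_col_iff by blast
    have "b \<in> pimage k (eclass \<A> ` y)"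
      using y(3) X(2) unfolding pimage_def by blast
    then have "b \<in> pimage g y"
      by (simp only: img[OF y(2)])
    then obtain Y where Y: "Y \<subseteq> pimage g y - {b}" "(Y, b) \<in> enabling B"
      using configuration_enabling_without ef_map_fam_configuration[OF g y(2)] by metis
    have "pimage g y \<subseteq> pimage k (X \<union> {e})"
      using pimage_mono[OF y(4)] img[OF y(2)] by metis
    \<comment> \<open>The event \<open>e\<close> contributes only the value \<open>b\<close> to the
      image, so whatever remains after deleting \<open>b\<close> comes from
      \<open>X\<close>.\<close>
    then have "pimage g y - {b} \<subseteq> pimage k X"
      using X(2) by (auto simp: pimage_def)
    then have "Y \<subseteq> pimage k X"
      using Y(1) by blast
    \<comment> \<open>Enabling is upward closed among consistent sets, so it passes from
      \<open>Y\<close> to the image of \<open>X\<close>.\<close>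
    then show ?thesis
      using Y(2) Con[OF y(1)] B unfolding general_event_structure_def by blast
  qed
  have "ran k \<subseteq> events B"
  proof
    fix b assume "b \<in> ran k"
    then obtain c where c: "k c = Some b" by (auto simp: ran_def)
    then have "c \<in> eclass \<A> ` \<Union>(family \<A>)"
      using dom unfolding events_col_eq by blast
    then obtain a y where a: "y \<in> family \<A>" "a \<in> y" "c = eclass \<A> a"
      by blast
    then have "g a = Some b"
      using k[of a] c by (metis UnionI)
    with a have "y \<in> family \<A>" "b \<in> pimage g y"
      by (auto simp: pimage_def)
    then show "b \<in> events B"
      using ef_map_fam_configuration[OF g] configurations_subset_events by blast
  qed
  then show ?thesis
    using dom Con inj enab unfolding es_map_def pfun_def by blast
qed

text \<open>Outside the underlying set both sides are \<open>None\<close>, the left through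
  \<open>eta\<close> and the right by the hypothesis on \<open>dom g\<close>, so only the values on
  classes matter.\<close>

lemma fam_map_eta_eq_iff:
  assumes "dom g \<subseteq> \<Union>(family \<A>)"
  shows "fam_map k \<circ>\<^sub>m eta \<A> = g \<longleftrightarrow> (\<forall>a\<in>\<Union>(family \<A>). k (eclass \<A> a) = g a)"
proof -
  have "(fam_map k \<circ>\<^sub>m eta \<A>) a = (if a \<in> \<Union>(family \<A>) then k (eclass \<A> a) else None)" for a
    by (simp add: map_comp_def eta_def fam_map_def)
  moreover have "g a = None" if "a \<notin> \<Union>(family \<A>)" for a
    using that assms by blast
  ultimately show ?thesis
    unfolding fun_eq_iff by metis
qed

theorem theorem6p1:
  fixes \<A> :: "'a equiv_family"
    and B :: "'b event_structure"
    and g :: "'a \<Rightarrow> 'b option"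
  assumes "equivalence_family \<A>"
    and "general_event_structure B"
    and "ef_map \<A> (fam B) g"
  shows "\<exists>!k. es_map (col \<A>) B k \<and> fam_map k \<circ>\<^sub>m eta \<A> = g"
proof -
  note eta_iff = fam_map_eta_eq_iff[OF ef_map_dom[OF assms(3)]]
  obtain k where dom: "dom k \<subseteq> events (col \<A>)"
    and k: "\<And>a. a \<in> \<Union>(family \<A>) \<Longrightarrow> k (eclass \<A> a) = g a"
    using ef_map_factors_eclass[OF assms(1,3)] by blast
  show ?thesis
  proof (rule ex1I[of _ k])
    show "es_map (col \<A>) B k \<and> fam_map k \<circ>\<^sub>m eta \<A> = g"
      unfolding eta_iff using es_map_col_factor[OF assms dom k] k by blast
  next
    fix k' assume k': "es_map (col \<A>) B k' \<and> fam_map k' \<circ>\<^sub>m eta \<A> = g"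
    show "k' = k"
    proof
      fix c
      show "k' c = k c"
      \<comment> \<open>Every event is some class, where \<open>g\<close> dictates the value of both
        maps; elsewhere both are \<open>None\<close> by their domain conditions.\<close>
      proof (cases "c \<in> events (col \<A>)")
        case True
        then show ?thesis
          using k k' unfolding eta_iff events_col_eq by force
      next
        case False
        moreover have "dom k' \<subseteq> events (col \<A>)"
          using k' by (simp add: es_map_def pfun_def)
        ultimately show ?thesis
          using dom by (metis domIff subsetD)
      qed
    qed
  qed
qed

end
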